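(* (1) For every generalized simplicial model $\mathcal C$, every world $w$ of $\mathcal C$ and every formula $\varphi\in\mathcal L_D$: $\mathcal C,w\models\varphi$ iff $\kappa(\mathcal C),w\models\varphi$. (2) For every partial epistemic model $M$ that is proper and has no empty world, every world $w$ of $M$ and every $\varphi\in\mathcal L_D$: $M,w\models\varphi$ iff $\sigma(M),X_w\models\varphi$.
   Context: Fix a finite set $A$ of agents and a countable set $\mathsf{AP}$ of atomic propositions. $\mathcal L_D$: $\varphi::=p\mid\neg\varphi\mid\varphi\wedge\varphi\mid D_B\varphi$, $p\in\mathsf{AP}$, $\emptyset\ne B\subseteq A$. A chromatic simplicial complex is $\langle V,S,\chi\rangle$ with $S$ a family of non-empty subsets of $V$ containing all singletons and closed under non-empty subsets, $\chi:V\to A$ injective on each simplex. A generalized simplicial model is $\mathcal C=\langle V,S,\chi,W,\ell\rangle$ with $\mathrm{Facets}\subseteq W\subseteq S$ and $\ell:W\to\mathcal P(\mathsf{AP})$; satisfaction: $\mathcal C,w\models p$ iff $p\in\ell(w)$, boolean clauses standard, $\mathcal C,w\models D_B\varphi$ iff $\mathcal C,w'\models\varphi$ for every $w'\in W$ with $B\subseteq\chi(w\cap w')$. A partial epistemic model is $M=\langle W,\sim,L\rangle$ with each $\sim_a$ a symmetric transitive relation on $W$ and $L:W\to\mathcal P(\mathsf{AP})$; $M,w\models p$ iff $p\in L(w)$, boolean clauses standard, $M,w\models D_B\varphi$ iff $M,w'\models\varphi$ for all $w'$ with $w\sim_a w'$ for every $a\in B$. $\mathrm{live}(w)=\{a:w\sim_a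 w\}$; no empty world: $\mathrm{live}(w)\ne\emptyset$ for all $w$; proper: for $w\neq w'$ with $\mathrm{live}(w)=\mathrm{live}(w')$ there is $a\in\mathrm{live}(w)$ with $w\not\sim_a w'$. $\kappa(\mathcal C)=\langle W,\sim,L\rangle$: same worlds, $w\sim_a w'$ iff $a\in\chi(w\cap w')$, $L=\ell$. $\sigma(M)$: with $[w]_a$ the $\sim_a$-class of $w$ for $a\in\mathrm{live}(w)$, vertices $v^w_a=(a,[w]_a)$; simplices are the sets $X_w=\{v^w_a: a\in\mathrm{live}(w)\}$ ($w\in W$) and their non-empty subsets; $\chi(v^w_a)=a$; worlds $\{X_w:w\in W\}$; labelling $\ell(X_w)=L(w)$. *)

theory Defs
  imports "HOL-Library.Countable_Set"
begin

datatype ('a, 'p) formula =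
    Atom 'p
  | Neg "('a, 'p) formula"
  | Conj "('a, 'p) formula" "('a, 'p) formula"
  | D "'a set" "('a, 'p) formula"

inductive_set lang_D :: "'a set \<Rightarrow> 'p set \<Rightarrow> ('a, 'p) formula set"
  for A :: "'a set" and AP :: "'p set" where
  Atom: "p \<in> AP \<Longrightarrow> Atom p \<in> lang_D A AP"
| Neg: "\<phi> \<in> lang_D A AP \<Longrightarrow> Neg \<phi> \<in> lang_D A AP"
| Conj: "\<phi> \<in> lang_D A AP \<Longrightarrow> \<psi> \<in> lang_D A AP \<Longrightarrow> Conj \<phi> \<psi> \<in> lang_D A AP"
| D: "B \<noteq> {} \<Longrightarrow> B \<subseteq> A \<Longrightarrow> \<phi> \<in> lang_D A AP \<Longrightarrow> D B \<phi> \<in> lang_D A AP"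

record ('v, 'a) chr_complex =
  verts :: "'v set"
  simplices :: "'v set set"
  color :: "'v \<Rightarrow> 'a"

definition chromatic_complex :: "'a set \<Rightarrow> ('v, 'a, 'z) chr_complex_scheme \<Rightarrow> bool" where
  "chromatic_complex A C \<longleftrightarrow>
     (\<forall>X \<in> simplices C. X \<noteq> {} \<and> X \<subseteq> verts C) \<and>
     (\<forall>v \<in> verts C. {v} \<in> simplices C) \<and>
     (\<forall>X \<in> simplices C. \<forall>Y. Y \<noteq> {} \<and> Y \<subseteq> X \<longrightarrow> Y \<in> simplices C) \<and>
     color C ` verts C \<subseteq> A \<and>
     (\<forall>X \<in> simplices C. inj_on (color C) X)"

definition facets :: "('v, 'a, 'z) chr_complex_scheme \<Rightarrow> 'v set set" where
  "facets C = {X \<in> simplices C. \<forall>Y \<in> simplices C. X \<subseteq> Y \<longrightarrow> Y = X}"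

record ('v, 'a, 'p) simp_model = "('v, 'a) chr_complex" +
  sworlds :: "'v set set"
  slabel :: "'v set \<Rightarrow> 'p set"

definition gen_simplicial_model :: "'a set \<Rightarrow> 'p set \<Rightarrow> ('v, 'a, 'p) simp_model \<Rightarrow> bool" where
  "gen_simplicial_model A AP C \<longleftrightarrow>
     chromatic_complex A C \<and>
     facets C \<subseteq> sworlds C \<and> sworlds C \<subseteq> simplices C \<and>
     (\<forall>w \<in> sworlds C. slabel C w \<subseteq> AP)"

primrec ssat :: "('v, 'a, 'p) simp_model \<Rightarrow> 'v set \<Rightarrow> ('a, 'p) formula \<Rightarrow> bool" where
  "ssat C w (Atom p) \<longleftrightarrow> p \<in> slabel C w"
| "ssat C w (Neg \<phi>) \<longleftrightarrow> \<not> ssat C w \<phi>"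
| "ssat C w (Conj \<phi> \<psi>) \<longleftrightarrow> ssat C w \<phi> \<and> ssat C w \<psi>"
| "ssat C w (D B \<phi>) \<longleftrightarrow> (\<forall>w' \<in> sworlds C. B \<subseteq> color C ` (w \<inter> w') \<longrightarrow> ssat C w' \<phi>)"

record ('w, 'a, 'p) epist_model =
  eworlds :: "'w set"
  indist :: "'a \<Rightarrow> ('w \<times> 'w) set"
  elabel :: "'w \<Rightarrow> 'p set"

definition partial_epistemic_model :: "'a set \<Rightarrow> 'p set \<Rightarrow> ('w, 'a, 'p) epist_model \<Rightarrow> bool" where
  "partial_epistemic_model A AP M \<longleftrightarrow>
     (\<forall>a \<in> A. indist M a \<subseteq> eworlds M \<times> eworlds M \<and> sym (indist M a) \<and> trans (indist M a)) \<and>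
     (\<forall>w \<in> eworlds M. elabel M w \<subseteq> AP)"

primrec esat :: "('w, 'a, 'p) epist_model \<Rightarrow> 'w \<Rightarrow> ('a, 'p) formula \<Rightarrow> bool" where
  "esat M w (Atom p) \<longleftrightarrow> p \<in> elabel M w"
| "esat M w (Neg \<phi>) \<longleftrightarrow> \<not> esat M w \<phi>"
| "esat M w (Conj \<phi> \<psi>) \<longleftrightarrow> esat M w \<phi> \<and> esat M w \<psi>"
| "esat M w (D B \<phi>) \<longleftrightarrow> (\<forall>w' \<in> eworlds M. (\<forall>a \<in> B. (w, w') \<in> indist M a) \<longrightarrow> esat M w' \<phi>)"

definition live :: "'a set \<Rightarrow> ('w, 'a, 'p) epist_model \<Rightarrow> 'w \<Rightarrow> 'a set" where
  "live A M w = {a \<in> A. (w, w) \<in> indist M a}"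

definition no_empty_world :: "'a set \<Rightarrow> ('w, 'a, 'p) epist_model \<Rightarrow> bool" where
  "no_empty_world A M \<longleftrightarrow> (\<forall>w \<in> eworlds M. live A M w \<noteq> {})"

definition proper :: "'a set \<Rightarrow> ('w, 'a, 'p) epist_model \<Rightarrow> bool" where
  "proper A M \<longleftrightarrow>
     (\<forall>w \<in> eworlds M. \<forall>w' \<in> eworlds M. w \<noteq> w' \<and> live A M w = live A M w' \<longrightarrow>
        (\<exists>a \<in> live A M w. (w, w') \<notin> indist M a))"

definition kappa :: "('v, 'a, 'p) simp_model \<Rightarrow> ('v set, 'a, 'p) epist_model" where
  "kappa C = \<lparr>
     eworlds = sworlds C,
     indist = (\<lambda>a. {(w, w'). w \<in> sworlds C \<and> w' \<in> sworlds C \<and> a \<in> color C ` (w \<inter> w')}),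
     elabel = slabel C\<rparr>"

definition view :: "('w, 'a, 'p) epist_model \<Rightarrow> 'a \<Rightarrow> 'w \<Rightarrow> 'a \<times> 'w set" where
  "view M a w = (a, indist M a `` {w})"

definition world_simplex :: "'a set \<Rightarrow> ('w, 'a, 'p) epist_model \<Rightarrow> 'w \<Rightarrow> ('a \<times> 'w set) set" where
  "world_simplex A M w = {view M a w | a. a \<in> live A M w}"

text \<open>
  The labelling of the simplicial model is required to send the simplex of a world \<open>w\<close> to the
  label of \<open>w\<close>. This determines a function only if distinct worlds have distinct simplices,
  which is what properness guarantees; see \<open>inj_on_world_simplex\<close> and \<open>slabel_sigma\<close> below.
\<close>

definition sigma :: "'a set \<Rightarrow> ('w, 'a, 'p) epist_model \<Rightarrow> ('a \<times> 'w set, 'a, 'p) simp_model" where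
  "sigma A M = \<lparr>
     verts = {view M a w | a w. w \<in> eworlds M \<and> a \<in> live A M w},
     simplices = {Y. Y \<noteq> {} \<and> (\<exists>w \<in> eworlds M. Y \<subseteq> world_simplex A M w)},
     color = fst,
     sworlds = world_simplex A M ` eworlds M,
     slabel = (\<lambda>X. elabel M (inv_into (eworlds M) (world_simplex A M) X))\<rparr>"

lemma partial_epistemic_model_kappa:
  assumes C: "gen_simplicial_model A AP C"
  shows "partial_epistemic_model A AP (kappa C)"
proof -
  have inj: "inj_on (color C) w" if "w \<in> sworlds C" for w
    using C that unfolding gen_simplicial_model_def chromatic_complex_def by blast
  have "trans (indist (kappa C) a)" for a
  proof (rule transI)
    fix x y z assume "(x, y) \<in> indist (kappa C) a" "(y, z) \<in> indist (kappa C) a"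
    then obtain u v where
      *: "x \<in> sworlds C" "y \<in> sworlds C" "z \<in> sworlds C" "u \<in> x" "u \<in> y" "v \<in> y" "v \<in> z"
         "a = color C u" "a = color C v"
      unfolding kappa_def by auto
    then have "u = v" using inj[of y] by (auto dest: inj_onD)
    with * show "(x, z) \<in> indist (kappa C) a" unfolding kappa_def by auto
  qed
  moreover have "sym (indist (kappa C) a)" for a
    unfolding kappa_def by (auto intro!: symI)
  ultimately show ?thesis
    using C unfolding partial_epistemic_model_def gen_simplicial_model_def
    by (auto simp: kappa_def)
qed

lemma inj_on_world_simplex:
  assumes "partial_epistemic_model A AP M" and "proper A M"
  shows "inj_on (world_simplex A M) (eworlds M)"
proof (rule inj_onI, rule ccontr)
  fix w w' assume w: "w \<in> eworlds M" "w' \<in> eworlds M" and "w \<noteq> w'"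
    and eq: "world_simplex A M w = world_simplex A M w'"
  have "fst ` world_simplex A M x = live A M x" for x
    unfolding world_simplex_def view_def by force
  with eq have live: "live A M w = live A M w'" by metis
  then obtain a where a: "a \<in> live A M w" "(w, w') \<notin> indist M a"
    using assms(2) w \<open>w \<noteq> w'\<close> unfolding proper_def by blast
  from a(1) have "view M a w \<in> world_simplex A M w'"
    using eq unfolding world_simplex_def by blast
  then have "indist M a `` {w} = indist M a `` {w'}"
    unfolding world_simplex_def view_def by auto
  moreover have "(w', w') \<in> indist M a"
    using a(1) live unfolding live_def by auto
  ultimately show False using a(2) by blast
qed

lemma slabel_sigma:
  assumes "partial_epistemic_model A AP M" and "proper A M" and "w \<in> eworlds M"
  shows "slabel (sigma A M) (world_simplex A M w) = elabel M w"
  using inv_into_f_f[OF inj_on_world_simplex[OF assms(1,2)] assms(3)] by (simp add: sigma_def)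

lemma gen_simplicial_model_sigma:
  assumes M: "partial_epistemic_model A AP M" "proper A M" and ne: "no_empty_world A M"
  shows "gen_simplicial_model A AP (sigma A M)"
proof -
  have ne': "world_simplex A M w \<noteq> {}" if "w \<in> eworlds M" for w
    using ne that unfolding no_empty_world_def world_simplex_def by blast
  have inj: "inj_on fst X" if "X \<subseteq> world_simplex A M w" for X w
  proof (rule inj_on_subset[OF _ that])
    show "inj_on fst (world_simplex A M w)"
      unfolding world_simplex_def view_def by (auto intro!: inj_onI)
  qed
  have "chromatic_complex A (sigma A M)"
    unfolding chromatic_complex_def
  proof (intro conjI)
    show "\<forall>X \<in> simplices (sigma A M). X \<noteq> {} \<and> X \<subseteq> verts (sigma A M)"
      unfolding sigma_def world_simplex_def by auto
    show "\<forall>v \<in> verts (sigma A M). {v} \<in> simplices (sigma A M)"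
      unfolding sigma_def world_simplex_def by auto
    show "\<forall>X \<in> simplices (sigma A M). \<forall>Y. Y \<noteq> {} \<and> Y \<subseteq> X \<longrightarrow> Y \<in> simplices (sigma A M)"
      unfolding sigma_def by simp (meson order_trans)
    show "color (sigma A M) ` verts (sigma A M) \<subseteq> A"
      unfolding sigma_def view_def live_def by auto
    show "\<forall>X \<in> simplices (sigma A M). inj_on (color (sigma A M)) X"
      using inj unfolding sigma_def by auto
  qed
  moreover have "facets (sigma A M) \<subseteq> sworlds (sigma A M)"
  proof
    fix X assume "X \<in> facets (sigma A M)"
    then obtain w where w: "w \<in> eworlds M" "X \<subseteq> world_simplex A M w"
      and max: "\<forall>Y \<in> simplices (sigma A M). X \<subseteq> Y \<longrightarrow> Y = X"
      unfolding facets_def sigma_def by auto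
    have "world_simplex A M w \<in> simplices (sigma A M)"
      using w ne' unfolding sigma_def by auto
    with max w have "world_simplex A M w = X" by blast
    with w show "X \<in> sworlds (sigma A M)" unfolding sigma_def by auto
  qed
  moreover have "sworlds (sigma A M) \<subseteq> simplices (sigma A M)"
    using ne' unfolding sigma_def by auto
  moreover have "\<forall>X \<in> sworlds (sigma A M). slabel (sigma A M) X \<subseteq> AP"
  proof
    fix X assume "X \<in> sworlds (sigma A M)"
    then obtain w where "w \<in> eworlds M" "X = world_simplex A M w"
      unfolding sigma_def by auto
    with M show "slabel (sigma A M) X \<subseteq> AP"
      using slabel_sigma[OF M] unfolding partial_epistemic_model_def by auto
  qed
  ultimately show ?thesis unfolding gen_simplicial_model_def by blast
qed

end

theory Submission
  imports Defs
begin

text \<open>Both parts go by induction on the formula, and only atoms and \<open>D B\<close> touch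
  the models. Under \<open>kappa\<close> the relations are read off from shared colours, so the two
  modal clauses agree at once. Under \<open>sigma\<close>, two world simplices share their
  \<open>a\<close>-vertex exactly when the worlds are \<open>a\<close>-related
  (\<open>color_world_simplex_Int_iff\<close>), and properness keeps labels well defined
  (\<open>slabel_sigma\<close>).\<close>

lemma ssat_iff_esat_kappa:
  assumes "w \<in> sworlds C"
  shows "ssat C w \<phi> \<longleftrightarrow> esat (kappa C) w \<phi>"
  using assms
proof (induction \<phi> arbitrary: w)
  case (D B \<phi>)
  have "B \<subseteq> color C ` (w \<inter> w') \<longleftrightarrow> (\<forall>a \<in> B. (w, w') \<in> indist (kappa C) a)"
    if "w' \<in> sworlds C" for w'
    using that D.prems by (auto simp: kappa_def)
  moreover have "eworlds (kappa C) = sworlds C"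
    by (simp add: kappa_def)
  ultimately show ?case
    using D.IH by simp
qed (simp_all add: kappa_def)

text \<open>Symmetry and transitivity make \<open>a\<close>-related worlds have the same \<open>a\<close>-class, hence the same
  \<open>a\<close>-coloured vertex.\<close>

lemma color_world_simplex_Int_iff:
  assumes M: "partial_epistemic_model A AP M" and a: "a \<in> A"
  shows "a \<in> fst ` (world_simplex A M w \<inter> world_simplex A M w') \<longleftrightarrow> (w, w') \<in> indist M a"
proof
  assume "a \<in> fst ` (world_simplex A M w \<inter> world_simplex A M w')"
  then have "indist M a `` {w} = indist M a `` {w'}" and "(w', w') \<in> indist M a"
    by (auto simp: world_simplex_def view_def live_def)
  \<comment> \<open>By reflexivity \<open>w'\<close> lies in its own class, which is also that of
    \<open>w\<close>.\<close>
  then show "(w, w') \<in> indist M a" by blast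
next
  assume r: "(w, w') \<in> indist M a"
  have s: "sym (indist M a)" and t: "trans (indist M a)"
    using M a by (auto simp: partial_epistemic_model_def)
  have r': "(w', w) \<in> indist M a" using r s by (rule symD[rotated])
  have "indist M a `` {w} = indist M a `` {w'}"
    using r r' t by (blast dest: transD)
  moreover have "a \<in> live A M w" "a \<in> live A M w'"
    using r r' t a by (auto simp: live_def dest: transD)
  ultimately have "view M a w \<in> world_simplex A M w \<inter> world_simplex A M w'"
    by (auto simp: world_simplex_def view_def)
  then show "a \<in> fst ` (world_simplex A M w \<inter> world_simplex A M w')"
    by (force simp: view_def)
qed

text \<open>The induction is over \<open>lang_D\<close> so that the modal case has
  \<open>B \<subseteq> A\<close>: the relations are known to be symmetric and transitive only for
  agents in \<open>A\<close>.\<close>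

lemma esat_iff_ssat_sigma:
  assumes M: "partial_epistemic_model A AP M" "proper A M"
    and "\<phi> \<in> lang_D A AP" and "w \<in> eworlds M"
  shows "esat M w \<phi> \<longleftrightarrow> ssat (sigma A M) (world_simplex A M w) \<phi>"
  using assms(3,4)
proof (induction \<phi> arbitrary: w rule: lang_D.induct)
  case (Atom p)
  \<comment> \<open>The label of a simplex is that of a chosen preimage; properness forces this
    preimage to be \<open>w\<close>.\<close>
  then show ?case by (simp add: slabel_sigma[OF M])
next
  case (D B \<phi>)
  have "B \<subseteq> fst ` (world_simplex A M w \<inter> world_simplex A M w') \<longleftrightarrow>
      (\<forall>a \<in> B. (w, w') \<in> indist M a)" for w'
    using D.hyps color_world_simplex_Int_iff[OF M(1)] by (meson subset_eq)
  moreover have "sworlds (sigma A M) = world_simplex A M ` eworlds M" "color (sigma A M) = fst"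
    by (simp_all add: sigma_def)
  ultimately show ?case
    using D.IH by simp
qed simp_all

theorem theorem31:
  fixes A :: "'a set" and AP :: "'p set"
  assumes "finite A" and "countable AP"
  shows "(\<forall>C :: ('v, 'a, 'p) simp_model. gen_simplicial_model A AP C \<longrightarrow>
            (\<forall>w \<in> sworlds C. \<forall>\<phi> \<in> lang_D A AP. ssat C w \<phi> \<longleftrightarrow> esat (kappa C) w \<phi>)) \<and>
         (\<forall>M :: ('w, 'a, 'p) epist_model.
            partial_epistemic_model A AP M \<and> proper A M \<and> no_empty_world A M \<longrightarrow>
            (\<forall>w \<in> eworlds M. \<forall>\<phi> \<in> lang_D A AP.
               esat M w \<phi> \<longleftrightarrow> ssat (sigma A M) (world_simplex A M w) \<phi>))"
  by (simp add: ssat_iff_esat_kappa esat_iff_ssat_sigma[where AP = AP])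

end
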